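(* Let $X$ be an infinite Fort space with particular point $b$, and let $C, D$ be nonempty subsets of $X$. Then the following hold (here "there exist $\lambda$ and a $C-(X,D,\lambda)$ Top-design of type 1" means that for some nonzero cardinal number $\lambda$ such a design exists, and "there is not any" means that none exists for any nonzero cardinal number $\lambda$). (a) Suppose $b\notin C\cup D$. (a$_1$) If $C$ is finite, then there is not any $C-(X,D,\lambda)$ Top-design of type 1. (a$_2$) If $C$ is infinite, ${\rm card}(C)\leq {\rm card}(D)$ and ${\rm card}(C)<{\rm card}(X)$, then there exist $\lambda$ and a $C-(X,D,\lambda)$ Top-design of type 1. (a$_3$) If ${\rm card}(C)={\rm card}(D)={\rm card}(X)$, then there exist $\lambda$ and a $C-(X,D,\lambda)$ Top-design of type 1 if and only if $D=X\setminus\{b\}$. (b) If $b\in C\setminus D$, then there is not any $C-(X,D,\lambda)$ Top-design of type 1. (c) Suppose $b\in D$. (c$_1$) If $C$ is finite, then there exist $\lambda$ and a $C-(X,D,\lambda)$ Top-design of type 1 if and only if ${\rm card}(C)+2\leq{\rm card}(D)$. (c$_2$) If $C$ is infinite and ${\rm card}(C)=\min({\rm card}(D),{\rm card}(C))<{\rm card}(X)$, then there exist $\lambda$ and a $C-(X,D,\lambda)$ Top-design of type 1. (c$_3$) If ${\rm card}(C)={\rm card}(D)={\rm card}(X)$, then there exist $\lambda$ and a $C-(X,D,\lambda)$ Top-design of type 1 if and only if $D=X$.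
   Context: A Fort space with particular point $b$ is a set $X$ with $b\in X$, equipped with the topology $\{U\subseteq X: b\notin U \text{ or } X\setminus U \text{ is finite}\}$. Subsets of $X$ carry the subspace topology, and $S\approx T$ means that $S$ and $T$ are homeomorphic. For a topological space $X$, nonempty subsets $C,D$ of $X$ and a nonzero (possibly infinite) cardinal number $\lambda$, a collection $\mathbb{A}$ of subsets of $X$ is a $C-(X,D,\lambda)$ Top-design of type 1 if: (i) for every $B\in\mathbb{A}$, $B\approx D$ and $X\setminus B\approx X\setminus D$; and (ii) for every $E\subseteq X$ with $E\approx C$, ${\rm card}(\{B\in\mathbb{A}:E\subseteq B\})=\lambda$. *)

theory Defs
  imports "HOL-Analysis.Analysis"
begin

unbundle cardinal_syntax

definition fort_topology :: "'a set \<Rightarrow> 'a \<Rightarrow> 'a topology" where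
  "fort_topology X b = topology (\<lambda>U. U \<subseteq> X \<and> (b \<notin> U \<or> finite (X - U)))"

lemma openin_fort_topology:
  "openin (fort_topology X b) U \<longleftrightarrow> U \<subseteq> X \<and> (b \<notin> U \<or> finite (X - U))"
proof -
  have "istopology (\<lambda>U. U \<subseteq> X \<and> (b \<notin> U \<or> finite (X - U)))"
    unfolding istopology_def
  proof (intro conjI allI impI)
    fix S T
    assume S: "S \<subseteq> X \<and> (b \<notin> S \<or> finite (X - S))" and T: "T \<subseteq> X \<and> (b \<notin> T \<or> finite (X - T))"
    show "S \<inter> T \<subseteq> X" using S by blast
    show "b \<notin> S \<inter> T \<or> finite (X - S \<inter> T)" using S T by (auto simp: Diff_Int)
  next
    fix \<K>
    assume K: "\<forall>K\<in>\<K>. K \<subseteq> X \<and> (b \<notin> K \<or> finite (X - K))"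
    show "\<Union>\<K> \<subseteq> X" using K by blast
    show "b \<notin> \<Union>\<K> \<or> finite (X - \<Union>\<K>)"
    proof (cases "b \<in> \<Union>\<K>")
      case True
      then obtain K where "K \<in> \<K>" "b \<in> K" by blast
      then have "finite (X - K)" "X - \<Union>\<K> \<subseteq> X - K" using K by auto
      then show ?thesis by (blast intro: finite_subset)
    qed simp
  qed
  then show ?thesis
    unfolding fort_topology_def by simp
qed

lemma topspace_fort_topology: "topspace (fort_topology X b) = X"
  by (metis Diff_cancel finite.emptyI openin_fort_topology openin_subset openin_topspace
      subset_antisym subset_refl)

text \<open>\<open>homeo_in T S U\<close>: the subsets \<open>S\<close> and \<open>U\<close> of the space \<open>T\<close> are homeomorphic
  in their subspace topologies.\<close>

abbreviation homeo_in :: "'a topology \<Rightarrow> 'a set \<Rightarrow> 'a set \<Rightarrow> bool" where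
  "homeo_in T S U \<equiv> subtopology T S homeomorphic_space subtopology T U"

text \<open>A cardinal number is represented by a cardinal order \<open>l\<close>, with \<open>=o\<close> as equality of
  cardinals.\<close>

definition top_design1 ::
    "'a topology \<Rightarrow> 'a set \<Rightarrow> 'a set \<Rightarrow> 'l rel \<Rightarrow> 'a set set \<Rightarrow> bool" where
  "top_design1 T C D l A \<longleftrightarrow>
     C \<noteq> {} \<and> C \<subseteq> topspace T \<and> D \<noteq> {} \<and> D \<subseteq> topspace T \<and> Cnotzero l \<and>
     A \<subseteq> Pow (topspace T) \<and>
     (\<forall>B\<in>A. homeo_in T B D \<and> homeo_in T (topspace T - B) (topspace T - D)) \<and>
     (\<forall>E. E \<subseteq> topspace T \<and> homeo_in T E C \<longrightarrow> |{B \<in> A. E \<subseteq> B}| =o l)"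

text \<open>Quantifying over cardinal orders on the type \<open>'a set\<close> loses no cardinal: see
  \<open>top_design1_imp_has_top_design1\<close>, where \<open>l\<close> lives on an arbitrary type.\<close>

definition has_top_design1 :: "'a topology \<Rightarrow> 'a set \<Rightarrow> 'a set \<Rightarrow> bool" where
  "has_top_design1 T C D \<longleftrightarrow> (\<exists>(l :: 'a set rel) A. top_design1 T C D l A)"

lemma top_design1_imp_has_top_design1:
  fixes T :: "'a topology" and l :: "'l rel"
  assumes "top_design1 T C D l A"
  shows "has_top_design1 T C D"
proof -
  define l' where "l' = |{B \<in> A. C \<subseteq> B}|"
  have C: "C \<subseteq> topspace T" and nz: "\<not> l =o (czero :: 'l rel)"
    and E: "\<And>E. E \<subseteq> topspace T \<Longrightarrow> homeo_in T E C \<Longrightarrow> |{B \<in> A. E \<subseteq> B}| =o l"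
    using assms by (auto simp: top_design1_def)
  have l': "l' =o l"
    unfolding l'_def using E[OF C] by (simp add: homeomorphic_space_refl)
  have "\<not> l' =o (czero :: 'a set rel)"
  proof
    assume "l' =o (czero :: 'a set rel)"
    then have "{B \<in> A. C \<subseteq> B} = {}"
      unfolding l'_def by (simp only: card_of_ordIso_czero_iff_empty)
    then have "l' =o (czero :: 'l rel)"
      unfolding l'_def by (simp only: card_of_ordIso_czero_iff_empty)
    with l' nz show False
      using ordIso_symmetric ordIso_transitive by blast
  qed
  moreover have "Card_order l'"
    unfolding l'_def by (rule card_of_Card_order)
  moreover have "|{B \<in> A. E \<subseteq> B}| =o l'" if "E \<subseteq> topspace T" "homeo_in T E C" for E
    using E[OF that] l' ordIso_symmetric ordIso_transitive by blast
  ultimately have "top_design1 T C D l' A"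
    using assms by (simp add: top_design1_def)
  then show ?thesis
    unfolding has_top_design1_def by blast
qed

definition cardinal_min :: "'a rel \<Rightarrow> 'a rel \<Rightarrow> 'a rel" where
  "cardinal_min r s = (if r \<le>o s then r else s)"

end

theory Submission
  imports Defs
begin

text \<open>
  In the subspace topology all points of \<open>S \<subseteq> X\<close> other than \<open>b\<close> are isolated, and \<open>b\<close>, if it
  lies in \<open>S\<close>, is isolated exactly when \<open>S\<close> is finite. So the homeomorphism type of \<open>S\<close> is its
  cardinality together with, for infinite \<open>S\<close>, the truth value of \<open>b \<in> S\<close>
  (\<open>homeo_in_fort_iff\<close>). As one of \<open>B\<close> and \<open>X - B\<close> is infinite, the admissible blocks are the
  sets \<open>B\<close> with the same cardinality, the same cardinality of the complement, and the same
  position relative to \<open>b\<close> as \<open>D\<close>. This turns the whole question into one about cardinals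
  (\<open>has_top_design1_fort_iff\<close>).

  For existence the family of all blocks is a design unless \<open>C\<close> is as large as \<open>X\<close>. Let \<open>D\<close> be
  infinite and let \<open>F\<close> be smaller than \<open>X\<close> and not larger than \<open>D\<close>. Squeezing \<open>X\<close> bijectively
  into \<open>X - (F - {b})\<close> and adjoining \<open>F\<close> sends an arbitrary block to a block through \<open>F\<close>
  injectively, so the blocks through \<open>F\<close> are as many as all blocks, whatever \<open>F\<close> is
  (\<open>infinite_blocks_through_eqpoll\<close>). If \<open>D\<close> is finite and contains \<open>b\<close>, the blocks through a
  copy \<open>E\<close> of \<open>C\<close> are those through \<open>insert b E\<close>, and there are \<open>|X|\<close> many of them
  as soon as at least one point remains to be chosen freely
  (\<open>finite_blocks_through_eqpoll\<close>). When \<open>D\<close> is \<open>X\<close> or \<open>X - {b}\<close>, the single block \<open>D\<close>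
  contains every copy of \<open>C\<close>.

  For non-existence, every copy of \<open>C\<close> must lie in some block (\<open>design_block_through\<close>). A copy
  through \<open>b\<close> forces \<open>b \<in> D\<close>; a copy containing \<open>X - {b}\<close> leaves at most \<open>b\<close> for
  the complement of a block; and for finite \<open>D\<close> with \<open>card D = card C + 1\<close> a copy
  avoiding \<open>b\<close> lies in exactly one block while a copy through \<open>b\<close> lies in infinitely many.
\<close>

section \<open>Cardinality\<close>

lemma lepoll_iff_card_of_ordLeq: "A \<lesssim> B \<longleftrightarrow> |A| \<le>o |B|"
  by (simp add: lepoll_def card_of_ordLeq)

lemma lesspoll_iff_card_of_ordLess: "A \<prec> B \<longleftrightarrow> |A| <o |B|"
  unfolding lesspoll_def lepoll_iff_card_of_ordLeq eqpoll_iff_card_of_ordIso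
  using ordLeq_iff_ordLess_or_ordIso not_ordLess_ordIso by blast

text \<open>Otherwise \<open>X\<close> would be the union of two sets of smaller cardinality.\<close>

lemma infinite_Diff_lesspoll_eqpoll:
  assumes "infinite X" and "F \<prec> X"
  shows "X - F \<approx> X"
proof (rule ccontr)
  assume "\<not> X - F \<approx> X"
  then have "X - F \<prec> X"
    by (metis Diff_subset lepoll_iff_leqpoll subset_imp_lepoll)
  then have "|(X - F) \<union> F| <o |X|"
    using assms card_of_Un_ordLess_infinite by (metis lesspoll_iff_card_of_ordLess)
  then have "X - F \<union> F \<prec> X"
    by (simp only: lesspoll_iff_card_of_ordLess)
  moreover have "X \<lesssim> X - F \<union> F"
    by (rule subset_imp_lepoll) auto
  ultimately have "X \<prec> X"
    by (rule lesspoll_trans1 [rotated])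
  then show False by simp
qed

lemma Un_lepoll_infinite:
  assumes "infinite D" and "A \<lesssim> D" and "B \<lesssim> D"
  shows "A \<union> B \<lesssim> D"
  using assms card_of_Un_ordLeq_infinite_Field [of "|D|" A B]
  by (simp add: lepoll_iff_card_of_ordLeq Field_card_of card_of_card_order_on)

text \<open>A set with \<open>k + 1\<close> elements arises by inserting one point into a set with \<open>k\<close> elements, and
  \<open>X \<times> X \<approx> X\<close>.\<close>

lemma card_subsets_lepoll:
  assumes "infinite X"
  shows "{B. B \<subseteq> X \<and> finite B \<and> card B = k} \<lesssim> X"
proof (induction k)
  case 0
  have "{B. B \<subseteq> X \<and> finite B \<and> card B = 0} \<subseteq> {{}}"
    by auto
  then have "{B. B \<subseteq> X \<and> finite B \<and> card B = 0} \<lesssim> {{} :: 'a set}"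
    by (rule subset_imp_lepoll)
  also have "{{} :: 'a set} \<lesssim> X"
    using assms by (simp add: finite_lepoll_infinite)
  finally show ?case .
next
  case (Suc k)
  let ?S = "\<lambda>k. {B. B \<subseteq> X \<and> finite B \<and> card B = k}"
  have "?S (Suc k) \<subseteq> (\<lambda>(x, B). insert x B) ` (X \<times> ?S k)"
  proof
    fix B assume B: "B \<in> ?S (Suc k)"
    then obtain x where x: "x \<in> B" by (auto simp: card_Suc_eq)
    have "B = (\<lambda>(x, B). insert x B) (x, B - {x})" and "(x, B - {x}) \<in> X \<times> ?S k"
      using B x by auto
    then show "B \<in> (\<lambda>(x, B). insert x B) ` (X \<times> ?S k)" by (rule image_eqI)
  qed
  then have "?S (Suc k) \<lesssim> X \<times> ?S k"
    by (rule subset_image_lepoll)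
  also have "X \<times> ?S k \<lesssim> X \<times> X"
    by (intro times_lepoll_mono lepoll_refl Suc)
  also have "X \<times> X \<approx> X"
    using assms by (simp add: eqpoll_iff_card_of_ordIso card_of_Times_same_infinite)
  finally show ?case .
qed

text \<open>A bijection can be taken to respect the point \<open>b\<close>: if \<open>b\<close> lies in both sets, a bijection
  between the sets without \<open>b\<close> is extended by \<open>b \<mapsto> b\<close>. Such maps carry the Fort topology of one set
  to that of the other, and they do not change whether a set contains \<open>b\<close>.\<close>

lemma eqpoll_pointed_bij:
  assumes "S \<approx> U" and "b \<in> S \<longleftrightarrow> b \<in> U"
  obtains f where "bij_betw f S U" and "\<And>x. x \<in> S \<Longrightarrow> f x = b \<longleftrightarrow> x = b"
proof (cases "b \<in> S")
  case False
  then obtain f where f: "bij_betw f S U" using assms(1) by (auto simp: eqpoll_def)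
  then have "f x \<noteq> b \<and> x \<noteq> b" if "x \<in> S" for x
    using that False assms(2) bij_betwE by blast
  with f that show thesis by blast
next
  case True
  then have "insert b (S - {b}) \<approx> insert b (U - {b})"
    using assms by (simp add: insert_absorb)
  then have "S - {b} \<approx> U - {b}"
    by (rule insert_eqpoll_insertD) auto
  then obtain f where f: "bij_betw f (S - {b}) (U - {b})" by (auto simp: eqpoll_def)
  define g where "g = f(b := b)"
  have "bij_betw g (S - {b}) (U - {b})"
    using f by (rule bij_betw_cong [THEN iffD1, rotated]) (simp add: g_def)
  moreover have "bij_betw g {b} {b}"
    by (simp add: g_def bij_betw_def)
  ultimately have "bij_betw g (S - {b} \<union> {b}) (U - {b} \<union> {b})"
    by (rule bij_betw_combine) auto
  moreover have "S - {b} \<union> {b} = S" "U - {b} \<union> {b} = U"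
    using True assms(2) by auto
  ultimately have "bij_betw g S U"
    by simp
  moreover have "g x = b \<longleftrightarrow> x = b" if "x \<in> S" for x
    using f that bij_betwE [OF f] by (auto simp: g_def)
  ultimately show thesis by (rule that)
qed

section \<open>Homeomorphic subsets of a Fort space\<close>

lemma openin_subtopology_fort:
  assumes "S \<subseteq> X"
  shows "openin (subtopology (fort_topology X b) S) V \<longleftrightarrow> V \<subseteq> S \<and> (b \<notin> V \<or> finite (S - V))"
proof
  assume "openin (subtopology (fort_topology X b) S) V"
  then obtain U where U: "U \<subseteq> X" "b \<notin> U \<or> finite (X - U)" "V = U \<inter> S"
    by (auto simp: openin_subtopology openin_fort_topology)
  have "S - V \<subseteq> X - U" using U assms by auto
  then show "V \<subseteq> S \<and> (b \<notin> V \<or> finite (S - V))"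
    using U finite_subset by blast
next
  assume V: "V \<subseteq> S \<and> (b \<notin> V \<or> finite (S - V))"
  show "openin (subtopology (fort_topology X b) S) V"
  proof (cases "b \<in> V")
    case True
    have "X - (V \<union> (X - S)) = S - V" using V assms by auto
    then have "openin (fort_topology X b) (V \<union> (X - S))"
      using True V assms by (auto simp: openin_fort_topology)
    moreover have "V = (V \<union> (X - S)) \<inter> S" using V by auto
    ultimately show ?thesis unfolding openin_subtopology by blast
  next
    case False
    then have "openin (fort_topology X b) V" using V assms by (auto simp: openin_fort_topology)
    moreover have "V = V \<inter> S" using V by auto
    ultimately show ?thesis unfolding openin_subtopology by blast
  qed
qed

text \<open>If \<open>b\<close> lies in an infinite \<open>S\<close>, then \<open>b\<close> is not isolated in \<open>S\<close>; but in a set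
  without \<open>b\<close> every point is isolated.\<close>

lemma homeo_in_fort_imp:
  assumes "S \<subseteq> X" and "U \<subseteq> X" and "homeo_in (fort_topology X b) S U"
  shows "S \<approx> U" and "infinite S \<Longrightarrow> b \<in> S \<Longrightarrow> b \<in> U"
proof -
  let ?T = "fort_topology X b"
  have top: "topspace (subtopology ?T S) = S" "topspace (subtopology ?T U) = U"
    using assms by (auto simp: topspace_fort_topology)
  obtain f where f: "homeomorphic_map (subtopology ?T S) (subtopology ?T U) f"
    using assms(3) homeomorphic_space by blast
  then have bij: "bij_betw f S U"
    unfolding bij_betw_def using homeomorphic_imp_surjective_map homeomorphic_imp_injective_map top
    by metis
  then show "S \<approx> U" by (auto simp: eqpoll_def)
  show "b \<in> U" if "infinite S" "b \<in> S"
  proof (rule ccontr)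
    assume "b \<notin> U"
    moreover have "f ` {b} \<subseteq> U" using bij that(2) by (auto simp: bij_betw_def)
    ultimately have "openin (subtopology ?T U) (f ` {b})"
      using assms(2) by (subst openin_subtopology_fort) auto
    then have "openin (subtopology ?T S) {b}"
      using homeomorphic_map_openness [OF f, of "{b}"] top that(2) by auto
    then show False using assms(1) that(1) by (simp add: openin_subtopology_fort)
  qed
qed

text \<open>Conversely, a bijection that respects \<open>b\<close> preserves the description of the open sets in
  \<open>openin_subtopology_fort\<close>. For finite sets every subset is open, and any bijection serves.\<close>

lemma homeo_in_fort_iff:
  assumes "S \<subseteq> X" and "U \<subseteq> X"
  shows "homeo_in (fort_topology X b) S U \<longleftrightarrow> S \<approx> U \<and> (finite S \<or> (b \<in> S \<longleftrightarrow> b \<in> U))"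
proof
  assume h: "homeo_in (fort_topology X b) S U"
  have "S \<approx> U" using homeo_in_fort_imp(1) assms h .
  moreover have "b \<in> S \<longleftrightarrow> b \<in> U" if "infinite S"
  proof -
    have "infinite U" using \<open>S \<approx> U\<close> that eqpoll_finite_iff by blast
    with that show ?thesis
      using homeo_in_fort_imp(2) assms h homeomorphic_space_sym by metis
  qed
  ultimately show "S \<approx> U \<and> (finite S \<or> (b \<in> S \<longleftrightarrow> b \<in> U))" by blast
next
  let ?T = "fort_topology X b"
  assume SU: "S \<approx> U \<and> (finite S \<or> (b \<in> S \<longleftrightarrow> b \<in> U))"
  obtain f where bij: "bij_betw f S U" and fb: "finite S \<or> (\<forall>x\<in>S. f x = b \<longleftrightarrow> x = b)"
  proof (cases "finite S")
    case True
    with SU that show thesis by (auto simp: eqpoll_def)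
  next
    case False
    then obtain f where "bij_betw f S U" "\<And>x. x \<in> S \<Longrightarrow> f x = b \<longleftrightarrow> x = b"
      using SU eqpoll_pointed_bij [of S U b] by blast
    with that show thesis by blast
  qed
  have top: "topspace (subtopology ?T S) = S" "topspace (subtopology ?T U) = U"
    using assms by (auto simp: topspace_fort_topology)
  have op: "openin (subtopology ?T U) (f ` V) \<longleftrightarrow> openin (subtopology ?T S) V" if V: "V \<subseteq> S" for V
  proof -
    have "f ` V \<subseteq> U" and "U - f ` V = f ` (S - V)" and inj: "inj_on f (S - V)"
      using bij V by (auto simp: bij_betw_def inj_on_def)
    then have fin: "finite (U - f ` V) \<longleftrightarrow> finite (S - V)"
      by (simp add: finite_image_iff)
    show ?thesis
    proof (cases "finite S")
      case True
      then show ?thesis using assms V fin \<open>f ` V \<subseteq> U\<close> by (simp add: openin_subtopology_fort)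
    next
      case False
      then have "b \<in> f ` V \<longleftrightarrow> b \<in> V" using fb V by (auto simp: image_iff) (metis subsetD)+
      then show ?thesis using assms V fin \<open>f ` V \<subseteq> U\<close> by (simp add: openin_subtopology_fort)
    qed
  qed
  have "homeomorphic_map (subtopology ?T S) (subtopology ?T U) f"
    unfolding homeomorphic_map_def quotient_map_def top
  proof (intro conjI allI impI)
    show "f ` S = U" and "inj_on f S" using bij by (auto simp: bij_betw_def)
    fix W assume "W \<subseteq> U"
    then have "f ` {x \<in> S. f x \<in> W} = W" using bij by (auto simp: bij_betw_def)
    then show "openin (subtopology ?T S) {x \<in> S. f x \<in> W} \<longleftrightarrow> openin (subtopology ?T U) W"
      using op [of "{x \<in> S. f x \<in> W}"] by auto
  qed
  then show "homeo_in ?T S U" by (rule homeomorphic_map_imp_homeomorphic_space)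
qed

section \<open>Designs in cardinal terms\<close>

definition fort_blocks :: "'a set \<Rightarrow> 'a \<Rightarrow> 'a set \<Rightarrow> 'a set set" where
  "fort_blocks X b D = {B. B \<subseteq> X \<and> B \<approx> D \<and> X - B \<approx> X - D \<and> (b \<in> B \<longleftrightarrow> b \<in> D)}"

text \<open>For a finite \<open>B\<close> its homeomorphism type does not decide whether \<open>b \<in> B\<close>, but then the one of
  the infinite complement does.\<close>

lemma homeo_in_fort_both_iff:
  assumes "infinite X" and "b \<in> X" and "B \<subseteq> X" and "D \<subseteq> X"
  shows "homeo_in (fort_topology X b) B D \<and> homeo_in (fort_topology X b) (X - B) (X - D)
    \<longleftrightarrow> B \<in> fort_blocks X b D"
proof -
  have "infinite B \<or> infinite (X - B)"
    using assms by (metis Diff_infinite_finite)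
  then show ?thesis
    using assms homeo_in_fort_iff [of B X D b] homeo_in_fort_iff [of "X - B" X "X - D" b]
    unfolding fort_blocks_def by auto
qed

text \<open>The cardinal of the design is read off as the number of blocks through \<open>C\<close> itself; it is
  nonzero when some \<open>B0\<close> in the family contains \<open>C\<close>.\<close>

lemma has_top_design1_fort_iff:
  assumes "infinite X" and "b \<in> X" and "C \<subseteq> X" and "C \<noteq> {}" and "D \<subseteq> X" and "D \<noteq> {}"
  shows "has_top_design1 (fort_topology X b) C D \<longleftrightarrow>
    (\<exists>A \<subseteq> fort_blocks X b D. \<exists>B0 \<in> A. C \<subseteq> B0 \<and>
      (\<forall>E. E \<subseteq> X \<and> E \<approx> C \<and> (finite C \<or> (b \<in> E \<longleftrightarrow> b \<in> C)) \<longrightarrow>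
        {B \<in> A. E \<subseteq> B} \<approx> {B \<in> A. C \<subseteq> B}))"
    (is "?L \<longleftrightarrow> ?R")
proof -
  let ?T = "fort_topology X b"
  have EC: "E \<approx> C \<and> (finite C \<or> (b \<in> E \<longleftrightarrow> b \<in> C)) \<longleftrightarrow> homeo_in ?T E C" if "E \<subseteq> X" for E
    using homeo_in_fort_iff [OF that assms(3), of b] eqpoll_finite_iff by blast
  show ?thesis
  proof
    assume ?L
    then obtain l :: "'a set rel" and A where d: "top_design1 ?T C D l A"
      unfolding has_top_design1_def by blast
    have l: "\<not> l =o (czero :: 'a set rel)"
      and cnt: "\<And>E. E \<subseteq> X \<Longrightarrow> homeo_in ?T E C \<Longrightarrow> |{B \<in> A. E \<subseteq> B}| =o l"
      using d by (auto simp: top_design1_def topspace_fort_topology)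
    have C: "|{B \<in> A. C \<subseteq> B}| =o l"
      using cnt assms(3) by (simp add: homeomorphic_space_refl)
    have sub: "A \<subseteq> fort_blocks X b D"
    proof
      fix B assume "B \<in> A"
      then have B: "B \<subseteq> X" and "homeo_in ?T B D \<and> homeo_in ?T (X - B) (X - D)"
        using d by (auto simp: top_design1_def topspace_fort_topology)
      then show "B \<in> fort_blocks X b D"
        by (simp only: homeo_in_fort_both_iff [OF assms(1,2) B assms(5)])
    qed
    have "{B \<in> A. C \<subseteq> B} \<noteq> {}"
    proof
      assume "{B \<in> A. C \<subseteq> B} = {}"
      then have "|{B \<in> A. C \<subseteq> B}| =o (czero :: 'a set rel)"
        by (simp only: card_of_ordIso_czero_iff_empty)
      with C l show False using ordIso_symmetric ordIso_transitive by blast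
    qed
    then obtain B0 where "B0 \<in> A" "C \<subseteq> B0" by blast
    moreover have "{B \<in> A. E \<subseteq> B} \<approx> {B \<in> A. C \<subseteq> B}"
      if "E \<subseteq> X \<and> E \<approx> C \<and> (finite C \<or> (b \<in> E \<longleftrightarrow> b \<in> C))" for E
      using that EC cnt C ordIso_symmetric ordIso_transitive
      unfolding eqpoll_iff_card_of_ordIso by blast
    ultimately show ?R using sub by blast
  next
    assume ?R
    then obtain A B0 where A: "A \<subseteq> fort_blocks X b D" "B0 \<in> A" "C \<subseteq> B0"
      and cnt: "\<And>E. E \<subseteq> X \<Longrightarrow> E \<approx> C \<Longrightarrow> finite C \<or> (b \<in> E \<longleftrightarrow> b \<in> C) \<Longrightarrow>
        {B \<in> A. E \<subseteq> B} \<approx> {B \<in> A. C \<subseteq> B}"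
      by blast
    have "{B \<in> A. C \<subseteq> B} \<noteq> {}" using A by blast
    then have "Cnotzero |{B \<in> A. C \<subseteq> B}|"
      by (simp add: card_of_ordIso_czero_iff_empty card_of_Card_order)
    moreover have "A \<subseteq> Pow X" using A by (auto simp: fort_blocks_def)
    moreover have "homeo_in ?T B D \<and> homeo_in ?T (X - B) (X - D)" if "B \<in> A" for B
    proof -
      have B: "B \<subseteq> X" using that \<open>A \<subseteq> Pow X\<close> by blast
      show ?thesis
        unfolding homeo_in_fort_both_iff [OF assms(1,2) B assms(5)] using that A(1) by blast
    qed
    moreover have "|{B \<in> A. E \<subseteq> B}| =o |{B \<in> A. C \<subseteq> B}|" if "E \<subseteq> X \<and> homeo_in ?T E C" for E
      using that cnt EC eqpoll_iff_card_of_ordIso by blast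
    ultimately have "top_design1 ?T C D |{B \<in> A. C \<subseteq> B}| A"
      using assms by (simp add: top_design1_def topspace_fort_topology)
    then show ?L unfolding has_top_design1_def by blast
  qed
qed

section \<open>Blocks through a small set\<close>

text \<open>A block \<open>B\<close> is sent to \<open>\<psi> ` B \<union> F\<close>, where \<open>\<psi>\<close> is a bijection from \<open>X\<close> onto \<open>X - (F - {b})\<close>
  that fixes \<open>b\<close>. This is again a block: its cardinality is that of \<open>D\<close> since \<open>D\<close> is infinite and
  \<open>F \<lesssim> D\<close>, and its complement is \<open>\<psi> ` (X - B)\<close>. The point \<open>b\<close> is kept out of the removed part
  so that membership of \<open>b\<close> is the same before and after.\<close>

lemma infinite_blocks_through_eqpoll:
  assumes "infinite X" and "b \<in> X" and "infinite D"
    and "F \<subseteq> X" and "F \<prec> X" and "F \<lesssim> D" and "b \<in> F \<Longrightarrow> b \<in> D"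
  shows "{B \<in> fort_blocks X b D. F \<subseteq> B} \<approx> fort_blocks X b D"
proof (rule lepoll_antisym)
  show "{B \<in> fort_blocks X b D. F \<subseteq> B} \<lesssim> fort_blocks X b D"
    by (rule subset_imp_lepoll) auto
  have "F - {b} \<prec> X"
    using assms(5) lesspoll_trans1 subset_imp_lepoll by (metis Diff_subset)
  then have "X \<approx> X - (F - {b})"
    using assms(1) by (simp add: infinite_Diff_lesspoll_eqpoll eqpoll_sym)
  then obtain \<psi> where \<psi>: "bij_betw \<psi> X (X - (F - {b}))" "\<And>x. x \<in> X \<Longrightarrow> \<psi> x = b \<longleftrightarrow> x = b"
    using assms(2) eqpoll_pointed_bij [of X "X - (F - {b})" b] by blast
  have inj: "inj_on \<psi> X" and img: "\<psi> ` X = X - (F - {b})" using \<psi>(1) by (auto simp: bij_betw_def)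
  let ?h = "\<lambda>B. \<psi> ` B \<union> F"
  have b_img: "b \<in> \<psi> ` B \<longleftrightarrow> b \<in> B" if "B \<subseteq> X" for B
    using that \<psi>(2) by (auto simp: image_iff) (metis subsetD)+
  have rec: "?h B - (F - {b}) = \<psi> ` B" if "B \<in> fort_blocks X b D" for B
  proof -
    have B: "B \<subseteq> X" "b \<in> F \<Longrightarrow> b \<in> B" using that assms(7) by (auto simp: fort_blocks_def)
    then have "\<psi> ` B \<inter> (F - {b}) = {}" using img by auto
    then show ?thesis using B b_img by blast
  qed
  \<comment> \<open>Injectivity: \<open>\<psi> ` B\<close> avoids \<open>F - {b}\<close>, so it can be recovered from the image of \<open>B\<close>.\<close>
  have "inj_on ?h (fort_blocks X b D)"
  proof (rule inj_onI)
    fix B B' assume B: "B \<in> fort_blocks X b D" "B' \<in> fort_blocks X b D" "?h B = ?h B'"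
    then have "\<psi> ` B = \<psi> ` B'" using rec by metis
    moreover have "B \<subseteq> X" "B' \<subseteq> X" using B by (auto simp: fort_blocks_def)
    ultimately show "B = B'" using inj inj_on_image_eq_iff by metis
  qed
  moreover have "?h B \<in> {B \<in> fort_blocks X b D. F \<subseteq> B}" if B: "B \<in> fort_blocks X b D" for B
  proof -
    have BX: "B \<subseteq> X" and BD: "B \<approx> D" and cB: "X - B \<approx> X - D" and bB: "b \<in> B \<longleftrightarrow> b \<in> D"
      using B by (auto simp: fort_blocks_def)
    have sub: "?h B \<subseteq> X" using BX img assms(4) by blast
    have "\<psi> ` B \<approx> B" using inj BX inj_on_image_eqpoll_self inj_on_subset by blast
    then have \<psi>D: "\<psi> ` B \<approx> D" using BD eqpoll_trans by blast
    have "?h B \<lesssim> D"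
      using assms(3,6) \<psi>D by (intro Un_lepoll_infinite) (auto intro: eqpoll_imp_lepoll)
    moreover have "D \<lesssim> ?h B"
      using \<psi>D by (meson eqpoll_sym lepoll_trans1 subset_imp_lepoll Un_upper1)
    ultimately have "?h B \<approx> D" by (rule lepoll_antisym)
    moreover have "X - ?h B \<approx> X - D"
    proof -
      have "b \<in> F \<Longrightarrow> b \<in> \<psi> ` B" using bB assms(7) b_img [OF BX] by blast
      then have "X - ?h B = X - (F - {b}) - \<psi> ` B" by blast
      also have "\<dots> = \<psi> ` (X - B)"
        using inj_on_image_set_diff [OF inj Diff_subset BX] img by simp
      also have "\<dots> \<approx> X - B"
        using inj inj_on_image_eqpoll_self inj_on_subset by (metis Diff_subset)
      finally show ?thesis using cB by (rule eqpoll_trans)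
    qed
    moreover have "b \<in> ?h B \<longleftrightarrow> b \<in> D" using b_img [OF BX] bB assms(7) by blast
    ultimately show ?thesis using sub by (auto simp: fort_blocks_def)
  qed
  ultimately show "fort_blocks X b D \<lesssim> {B \<in> fort_blocks X b D. F \<subseteq> B}"
    unfolding lepoll_def by blast
qed

text \<open>The condition on complements disappears, since all of them are equipotent to \<open>X\<close>.\<close>

lemma finite_fort_blocks:
  assumes "infinite X" and "D \<subseteq> X" and "finite D" and "b \<in> D"
  shows "fort_blocks X b D = {B. B \<subseteq> X \<and> finite B \<and> card B = card D \<and> b \<in> B}"
proof -
  have co: "X - B \<approx> X" if "finite B" for B
    using assms(1) that finite_lesspoll_infinite infinite_Diff_lesspoll_eqpoll by blast
  have "X - B \<approx> X - D" if "finite B" for B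
    using co [OF that] eqpoll_sym [OF co [OF assms(3)]] by (rule eqpoll_trans)
  moreover have "B \<approx> D \<longleftrightarrow> finite B \<and> card B = card D" for B
    using assms(3) eqpoll_finite_iff eqpoll_iff_card by metis
  ultimately show ?thesis
    using assms(4) unfolding fort_blocks_def by blast
qed

text \<open>Enlarge \<open>F\<close> to a set \<open>G\<close> with one element fewer than a block. Inserting any of the points
  outside \<open>G\<close> yields pairwise distinct blocks, and the number of finite subsets of fixed size
  gives the upper bound.\<close>

lemma finite_blocks_through_eqpoll:
  assumes "infinite X" and "D \<subseteq> X" and "finite D" and "b \<in> D"
    and "F \<subseteq> X" and "finite F" and "b \<in> F" and "card F < card D"
  shows "{B \<in> fort_blocks X b D. F \<subseteq> B} \<approx> X"
proof (rule lepoll_antisym)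
  have "{B \<in> fort_blocks X b D. F \<subseteq> B} \<subseteq> {B. B \<subseteq> X \<and> finite B \<and> card B = card D}"
    using assms by (auto simp: finite_fort_blocks)
  then show "{B \<in> fort_blocks X b D. F \<subseteq> B} \<lesssim> X"
    by (rule lepoll_trans [OF subset_imp_lepoll card_subsets_lepoll [OF assms(1)]])
  obtain G where G: "F \<subseteq> G" "G \<subseteq> X" "finite G" "card G = card D - 1"
  proof -
    have "infinite (X - F)" using assms(1,6) by auto
    then obtain H where "H \<subseteq> X - F" "finite H" "card H = card D - 1 - card F"
      using infinite_arbitrarily_large by metis
    then have "card (F \<union> H) = card D - 1"
      using assms by (subst card_Un_disjoint) auto
    with that [of "F \<union> H"] \<open>H \<subseteq> X - F\<close> \<open>finite H\<close> assms show thesis by blast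
  qed
  have "X \<approx> X - G"
    using assms(1) G(3) by (intro eqpoll_sym [OF infinite_Diff_lesspoll_eqpoll] finite_lesspoll_infinite)
  also have "X - G \<lesssim> {B \<in> fort_blocks X b D. F \<subseteq> B}"
    unfolding lepoll_def
  proof (intro exI conjI)
    show "inj_on (\<lambda>y. insert y G) (X - G)" by (auto simp: inj_on_def)
    show "(\<lambda>y. insert y G) ` (X - G) \<subseteq> {B \<in> fort_blocks X b D. F \<subseteq> B}"
      using G assms by (auto simp: finite_fort_blocks)
  qed
  finally show "X \<lesssim> {B \<in> fort_blocks X b D. F \<subseteq> B}" .
qed

section \<open>Existence and non-existence of designs\<close>

lemma design_of_all_blocks:
  assumes "infinite X" and "b \<in> X" and "C \<subseteq> X" and "C \<noteq> {}" and "D \<subseteq> X" and "D \<noteq> {}"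
    and "K \<noteq> {}"
    and K: "\<And>E. E \<subseteq> X \<Longrightarrow> E \<approx> C \<Longrightarrow> finite C \<or> (b \<in> E \<longleftrightarrow> b \<in> C) \<Longrightarrow>
      {B \<in> fort_blocks X b D. E \<subseteq> B} \<approx> K"
  shows "has_top_design1 (fort_topology X b) C D"
proof -
  let ?A = "fort_blocks X b D"
  have C: "{B \<in> ?A. C \<subseteq> B} \<approx> K" using K assms(3) by blast
  then have "{B \<in> ?A. C \<subseteq> B} \<noteq> {}" using assms(7) by (metis eqpoll_empty_iff_empty eqpoll_sym)
  then obtain B0 where "B0 \<in> ?A" "C \<subseteq> B0" by blast
  moreover have "{B \<in> ?A. E \<subseteq> B} \<approx> {B \<in> ?A. C \<subseteq> B}"
    if "E \<subseteq> X \<and> E \<approx> C \<and> (finite C \<or> (b \<in> E \<longleftrightarrow> b \<in> C))" for E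
    using eqpoll_trans [OF K [of E] eqpoll_sym [OF C]] that by blast
  ultimately show ?thesis
    unfolding has_top_design1_fort_iff [OF assms(1-6)] by blast
qed

text \<open>The last hypothesis guarantees that no copy of \<open>C\<close> contains \<open>b\<close> unless the blocks do.\<close>

lemma design_of_infinite_block:
  assumes "infinite X" and "b \<in> X" and "C \<subseteq> X" and "C \<noteq> {}" and "D \<subseteq> X"
    and "infinite D" and "C \<lesssim> D" and "C \<prec> X" and "b \<in> D \<or> (infinite C \<and> b \<notin> C)"
  shows "has_top_design1 (fort_topology X b) C D"
proof (rule design_of_all_blocks [OF assms(1-5)])
  show "D \<noteq> {}" using assms(6) by auto
  have "D \<in> fort_blocks X b D" using assms(5) by (auto simp: fort_blocks_def)
  then show "fort_blocks X b D \<noteq> {}" by blast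
  fix E assume E: "E \<subseteq> X" "E \<approx> C" "finite C \<or> (b \<in> E \<longleftrightarrow> b \<in> C)"
  then show "{B \<in> fort_blocks X b D. E \<subseteq> B} \<approx> fort_blocks X b D"
    using assms by (intro infinite_blocks_through_eqpoll)
      (auto intro: eq_lesspoll_trans lepoll_trans1)
qed

text \<open>Here copies of \<open>C\<close> may or may not contain \<open>b\<close>, so a block must leave a free choice
  after \<open>card C + 1\<close> points. This is where the summand 2 comes from.\<close>

lemma design_of_finite_block:
  assumes "infinite X" and "b \<in> X" and "C \<subseteq> X" and "C \<noteq> {}" and "D \<subseteq> X"
    and "finite C" and "finite D" and "b \<in> D" and "card C + 2 \<le> card D"
  shows "has_top_design1 (fort_topology X b) C D"
proof (rule design_of_all_blocks [OF assms(1-5)])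
  show "D \<noteq> {}" "X \<noteq> {}" using assms by auto
  fix E assume E: "E \<subseteq> X" "E \<approx> C"
  then have "finite E" "card E = card C"
    using assms(6) eqpoll_finite_iff eqpoll_iff_card by blast+
  then have "card (insert b E) < card D"
    using assms(9) by (simp add: card_insert_if)
  then have "{B \<in> fort_blocks X b D. insert b E \<subseteq> B} \<approx> X"
    using assms E \<open>finite E\<close> by (intro finite_blocks_through_eqpoll) auto
  moreover have "{B \<in> fort_blocks X b D. insert b E \<subseteq> B} = {B \<in> fort_blocks X b D. E \<subseteq> B}"
    using assms(8) by (auto simp: fort_blocks_def)
  ultimately show "{B \<in> fort_blocks X b D. E \<subseteq> B} \<approx> X" by simp
qed

lemma design_of_single_block:
  assumes "infinite X" and "b \<in> X" and "C \<subseteq> X" and "infinite C"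
    and "D = X \<or> D = X - {b} \<and> b \<notin> C"
  shows "has_top_design1 (fort_topology X b) C D"
proof -
  have "C \<subseteq> D" using assms(3,5) by blast
  then have D: "D \<subseteq> X" "C \<noteq> {}" "D \<noteq> {}" using assms(4,5) by auto
  have "D \<in> fort_blocks X b D" using D(1) by (auto simp: fort_blocks_def)
  moreover have "{B \<in> {D}. E \<subseteq> B} \<approx> {B \<in> {D}. C \<subseteq> B}"
    if "E \<subseteq> X \<and> E \<approx> C \<and> (finite C \<or> (b \<in> E \<longleftrightarrow> b \<in> C))" for E
  proof -
    have "E \<subseteq> D" using that assms(4,5) by blast
    then have "{B \<in> {D}. E \<subseteq> B} = {B \<in> {D}. C \<subseteq> B}" using \<open>C \<subseteq> D\<close> by blast
    then show ?thesis by simp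
  qed
  ultimately show ?thesis
    using \<open>C \<subseteq> D\<close>
    unfolding has_top_design1_fort_iff [OF assms(1-3) D(2,1,3)]
    by (intro exI [of _ "{D}"] conjI bexI [of _ D]) auto
qed

lemma design_block_through:
  assumes "infinite X" and "b \<in> X" and "C \<subseteq> X" and "C \<noteq> {}" and "D \<subseteq> X" and "D \<noteq> {}"
    and "has_top_design1 (fort_topology X b) C D"
    and "E \<subseteq> X" and "E \<approx> C" and "finite C \<or> (b \<in> E \<longleftrightarrow> b \<in> C)"
  obtains B where "B \<in> fort_blocks X b D" and "E \<subseteq> B"
proof -
  obtain A B0 where A: "A \<subseteq> fort_blocks X b D" "B0 \<in> A" "C \<subseteq> B0"
    and "{B \<in> A. E \<subseteq> B} \<approx> {B \<in> A. C \<subseteq> B}"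
    using assms(7-10) unfolding has_top_design1_fort_iff [OF assms(1-6)] by blast
  then have "{B \<in> A. E \<subseteq> B} \<noteq> {}"
    by (metis (mono_tags, lifting) empty_Collect_eq eqpoll_empty_iff_empty eqpoll_sym)
  with A that show thesis by blast
qed

text \<open>A finite \<open>C\<close> has a copy that contains \<open>b\<close>, obtained by exchanging one of its points for \<open>b\<close>.\<close>

lemma design_imp_point_in_block:
  assumes "infinite X" and "b \<in> X" and "C \<subseteq> X" and "C \<noteq> {}" and "D \<subseteq> X" and "D \<noteq> {}"
    and "has_top_design1 (fort_topology X b) C D"
    and "finite C \<or> b \<in> C"
  shows "b \<in> D"
proof -
  obtain E where E: "E \<subseteq> X" "E \<approx> C" "b \<in> E"
  proof (cases "b \<in> C")
    case True
    with that assms(3) show thesis by blast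
  next
    case False
    obtain c where "c \<in> C" using assms(4) by blast
    then have "insert b (C - {c}) \<approx> insert c (C - {c})"
      using False by (intro insert_eqpoll_cong) auto
    with that [of "insert b (C - {c})"] \<open>c \<in> C\<close> assms(2,3) show thesis
      by (auto simp: insert_absorb)
  qed
  then obtain B where "B \<in> fort_blocks X b D" "E \<subseteq> B"
    using assms(8) design_block_through [OF assms(1-7)] by blast
  with E(3) show ?thesis by (auto simp: fort_blocks_def)
qed

text \<open>The set \<open>X\<close> or \<open>X - {b}\<close> is a copy of \<open>C\<close>, so some block is \<open>X\<close> or \<open>X - {b}\<close>. Complements of
  blocks are equipotent to \<open>X - D\<close>, which makes \<open>X - D\<close> empty or the singleton of \<open>b\<close>.\<close>

lemma full_size_design_imp:
  assumes "infinite X" and "b \<in> X" and "C \<subseteq> X" and "D \<subseteq> X" and "D \<noteq> {}"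
    and "has_top_design1 (fort_topology X b) C D"
    and "C \<approx> X"
  shows "X - {b} \<subseteq> D"
proof -
  have C: "infinite C" using assms(1,7) eqpoll_finite_iff by blast
  then have "C \<noteq> {}" by auto
  let ?E = "if b \<in> C then X else X - {b}"
  have "insert b (X - {b}) \<approx> X - {b}"
    using assms(1) by (intro infinite_insert_eqpoll) auto
  then have "X - {b} \<approx> X"
    using assms(2) by (simp add: insert_absorb eqpoll_sym)
  then have "?E \<approx> C"
    using eqpoll_trans [OF _ eqpoll_sym [OF assms(7)], of ?E] by simp
  moreover have "b \<in> ?E \<longleftrightarrow> b \<in> C" "?E \<subseteq> X" using assms(2) by auto
  ultimately obtain B where B: "B \<in> fort_blocks X b D" "?E \<subseteq> B"
    using design_block_through [OF assms(1-3) \<open>C \<noteq> {}\<close> assms(4-6), of ?E] by blast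
  then have "X - {b} \<subseteq> B" "B \<subseteq> X" "X - B \<approx> X - D" "b \<in> B \<longleftrightarrow> b \<in> D"
    by (auto simp: fort_blocks_def split: if_splits)
  show "X - {b} \<subseteq> D"
  proof (cases "b \<in> D")
    case True
    then have "X - B = {}" using \<open>X - {b} \<subseteq> B\<close> \<open>b \<in> B \<longleftrightarrow> b \<in> D\<close> by blast
    then have "X - D = {}"
      using \<open>X - B \<approx> X - D\<close> by (metis eqpoll_empty_iff_empty eqpoll_sym)
    then show ?thesis by blast
  next
    case False
    then have "X - B = {b}"
      using \<open>X - {b} \<subseteq> B\<close> \<open>b \<in> B \<longleftrightarrow> b \<in> D\<close> assms(2) by blast
    then obtain u where u: "X - D = {u}"
      using eqpoll_sym [OF \<open>X - B \<approx> X - D\<close>] by (auto simp: eqpoll_singleton_iff)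
    then have "b \<in> {u}" using False assms(2) by blast
    with u show ?thesis by blast
  qed
qed

text \<open>Suppose \<open>card D \<le> card C + 1\<close>. Since blocks contain \<open>b\<close>, a copy \<open>E\<close> of \<open>C\<close> without \<open>b\<close> can only
  lie in the block \<open>insert b E\<close>, so the cardinal of the design is 1 and all such sets are blocks.
  Then a copy \<open>G\<close> through \<open>b\<close> lies in the block \<open>insert x G\<close> for each of the infinitely many
  points \<open>x \<notin> G\<close>, a contradiction.\<close>

lemma finite_design_imp_card_le:
  assumes "infinite X" and "b \<in> X" and "C \<subseteq> X" and "C \<noteq> {}" and "D \<subseteq> X"
    and "has_top_design1 (fort_topology X b) C D"
    and "finite C" and "finite D" and "b \<in> D"
  shows "card C + 2 \<le> card D"
proof (rule ccontr)
  assume "\<not> card C + 2 \<le> card D"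
  then have le: "card D \<le> card C + 1" by simp
  have "D \<noteq> {}" using assms(9) by auto
  obtain A where A: "A \<subseteq> fort_blocks X b D" and "\<exists>B0 \<in> A. C \<subseteq> B0"
    and cnt: "\<And>E. E \<subseteq> X \<Longrightarrow> E \<approx> C \<Longrightarrow> {B \<in> A. E \<subseteq> B} \<approx> {B \<in> A. C \<subseteq> B}"
    using assms(6,7)
    unfolding has_top_design1_fort_iff [OF assms(1-5) \<open>D \<noteq> {}\<close>] by blast
  then have ne: "{B \<in> A. C \<subseteq> B} \<noteq> {}" by blast
  have eqC: "E \<approx> C" if "finite E" "card E = card C" for E
    using that assms(7) by (simp add: eqpoll_iff_card)
  have only: "{B \<in> A. E \<subseteq> B} = {insert b E}"
    if E: "E \<subseteq> X" "finite E" "card E = card C" "b \<notin> E" for E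
  proof -
    have "B = insert b E" if B: "B \<in> A" "E \<subseteq> B" for B
    proof -
      have "finite B" "card B = card D" "b \<in> B"
        using A B(1) assms by (auto simp: finite_fort_blocks)
      then show ?thesis
        using B(2) E le card_seteq [of B "insert b E"] by auto
    qed
    moreover have "{B \<in> A. E \<subseteq> B} \<noteq> {}"
      using cnt [OF E(1) eqC [OF E(2,3)]] ne by (metis eqpoll_empty_iff_empty eqpoll_sym)
    ultimately show ?thesis by blast
  qed
  have "infinite (X - {b})" using assms(1) by simp
  then obtain E where E: "E \<subseteq> X - {b}" "finite E" "card E = card C"
    using infinite_arbitrarily_large by metis
  then have "{B \<in> A. E \<subseteq> B} = {insert b E}" using only by blast
  then have "{B \<in> A. C \<subseteq> B} \<approx> {insert b E}"
    using eqpoll_sym [OF cnt [of E]] E eqC by auto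
  moreover obtain e where "e \<in> E" using E assms(4,7) by fastforce
  define G where "G = insert b (E - {e})"
  have G: "G \<subseteq> X" "finite G" "card G = card C" "b \<in> G"
    using E \<open>e \<in> E\<close> assms(2) card_Suc_Diff1 [of E e] by (auto simp: G_def card_insert_if)
  ultimately have "{B \<in> A. G \<subseteq> B} \<approx> {insert b E}"
    using eqpoll_trans [OF cnt [of G]] eqC by blast
  then obtain B1 where B1: "{B \<in> A. G \<subseteq> B} = {B1}"
    by (auto simp: eqpoll_singleton_iff)
  have B1_eq: "insert x G = B1" if x: "x \<in> X - G" for x
  proof -
    \<comment> \<open>Exchanging \<open>b\<close> for \<open>x\<close> in \<open>G\<close> gives a copy of \<open>C\<close> without \<open>b\<close>.\<close>
    let ?H = "insert x (G - {b})"
    have "card ?H = card C" using G x card_Suc_Diff1 [of G b] by auto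
    then have "{B \<in> A. ?H \<subseteq> B} = {insert b ?H}"
      using G x by (intro only) auto
    moreover have "insert b ?H = insert x G" using G(4) by blast
    ultimately have "insert x G \<in> A" by (metis (no_types, lifting) insertI1 mem_Collect_eq)
    then have "insert x G \<in> {B \<in> A. G \<subseteq> B}" by blast
    then show ?thesis unfolding B1 by simp
  qed
  have "X - G \<subseteq> B1" using B1_eq by blast
  moreover have "finite B1"
    using B1 A assms by (auto simp: finite_fort_blocks)
  ultimately have "finite (X - G)" by (rule finite_subset)
  with G(2) assms(1) show False by simp
qed

lemma csum_ctwo_ordLeq_iff:
  assumes "finite C"
  shows "|C| +c ctwo \<le>o |D| \<longleftrightarrow> infinite D \<or> card C + 2 \<le> card D"
proof -
  let ?P = "C <+> (UNIV :: bool set)"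
  have fin: "finite ?P" and card: "card ?P = card C + 2"
    using assms by (auto simp: card_Plus)
  have "|C| +c ctwo \<le>o |D| \<longleftrightarrow> ?P \<lesssim> D"
    by (simp add: csum_def ctwo_def Field_card_of lepoll_iff_card_of_ordLeq)
  also have "\<dots> \<longleftrightarrow> infinite D \<or> card C + 2 \<le> card D"
    using fin card finite_lepoll_infinite lepoll_iff_card_le by metis
  finally show ?thesis .
qed

theorem theorem2p2:
  fixes X C D :: "'a set" and b :: 'a and T :: "'a topology"
  defines "T \<equiv> fort_topology X b"
  assumes "infinite X" and "b \<in> X"
    and "C \<subseteq> X" and "C \<noteq> {}" and "D \<subseteq> X" and "D \<noteq> {}"
  shows
    "(b \<notin> C \<union> D \<longrightarrow>
        (finite C \<longrightarrow> \<not> has_top_design1 T C D) \<and>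
        (infinite C \<and> |C| \<le>o |D| \<and> |C| <o |X| \<longrightarrow> has_top_design1 T C D) \<and>
        ( |C| =o |D| \<and> |D| =o |X| \<longrightarrow> (has_top_design1 T C D \<longleftrightarrow> D = X - {b}))) \<and>
     (b \<in> C - D \<longrightarrow> \<not> has_top_design1 T C D) \<and>
     (b \<in> D \<longrightarrow>
        (finite C \<longrightarrow> (has_top_design1 T C D \<longleftrightarrow> |C| +c ctwo \<le>o |D| )) \<and>
        (infinite C \<and> |C| =o cardinal_min |D| |C| \<and> cardinal_min |D| |C| <o |X| \<longrightarrow>
           has_top_design1 T C D) \<and>
        ( |C| =o |D| \<and> |D| =o |X| \<longrightarrow> (has_top_design1 T C D \<longleftrightarrow> D = X)))"
proof -
  note basic = assms(2-7)
  have single: "has_top_design1 T C D"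
    if "|C| =o |D|" "|D| =o |X|" "D = X \<or> D = X - {b} \<and> b \<notin> C"
  proof -
    have "infinite C"
      using card_of_ordIso_finite [OF ordIso_transitive [OF that(1,2)]] assms(2) by simp
    then show ?thesis
      unfolding T_def using design_of_single_block [OF basic(1-3)] that(3) by simp
  qed
  have full: "X - {b} \<subseteq> D" if "has_top_design1 T C D" "|C| =o |D|" "|D| =o |X|"
    using full_size_design_imp [OF basic(1-3,5,6)] that(1) ordIso_transitive [OF that(2,3)]
    unfolding T_def eqpoll_iff_card_of_ordIso by blast
  have pt: "b \<in> D" if "has_top_design1 T C D" "finite C \<or> b \<in> C"
    using that design_imp_point_in_block [OF basic] unfolding T_def by blast
  have inf: "has_top_design1 T C D"
    if "|C| \<le>o |D|" "|C| <o |X|" "infinite D" "b \<in> D \<or> infinite C \<and> b \<notin> C"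
    unfolding T_def using that basic
    by (intro design_of_infinite_block) (auto simp: lepoll_iff_card_of_ordLeq lesspoll_iff_card_of_ordLess)
  have infD: "infinite D" if "infinite C" "|C| \<le>o |D|"
    using that card_of_ordLeq_finite by blast
  have a: "(finite C \<longrightarrow> \<not> has_top_design1 T C D) \<and>
        (infinite C \<and> |C| \<le>o |D| \<and> |C| <o |X| \<longrightarrow> has_top_design1 T C D) \<and>
        ( |C| =o |D| \<and> |D| =o |X| \<longrightarrow> (has_top_design1 T C D \<longleftrightarrow> D = X - {b}))"
    if b: "b \<notin> C \<union> D"
  proof (intro conjI impI)
    show "\<not> has_top_design1 T C D" if "finite C" using pt that b by blast
    show "has_top_design1 T C D" if "infinite C \<and> |C| \<le>o |D| \<and> |C| <o |X|"
      using that inf infD b by blast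
    show "has_top_design1 T C D \<longleftrightarrow> D = X - {b}" if "|C| =o |D| \<and> |D| =o |X|"
      using that full single b assms(6) by blast
  qed
  have c: "(finite C \<longrightarrow> (has_top_design1 T C D \<longleftrightarrow> |C| +c ctwo \<le>o |D| )) \<and>
        (infinite C \<and> |C| =o cardinal_min |D| |C| \<and> cardinal_min |D| |C| <o |X| \<longrightarrow>
           has_top_design1 T C D) \<and>
        ( |C| =o |D| \<and> |D| =o |X| \<longrightarrow> (has_top_design1 T C D \<longleftrightarrow> D = X))"
    if b: "b \<in> D"
  proof (intro conjI impI)
    assume C: "finite C"
    have "has_top_design1 T C D" if "infinite D"
    proof (rule inf)
      show "|C| \<le>o |D|" "|C| <o |X|"
        using C that assms(2) finite_lepoll_infinite finite_lesspoll_infinite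
        by (auto simp flip: lepoll_iff_card_of_ordLeq lesspoll_iff_card_of_ordLess)
    qed (use that b in auto)
    then show "has_top_design1 T C D \<longleftrightarrow> |C| +c ctwo \<le>o |D|"
      using C b basic finite_design_imp_card_le [of X b C D] design_of_finite_block [of X b C D]
      unfolding csum_ctwo_ordLeq_iff [OF C] T_def by blast
  next
    assume h: "infinite C \<and> |C| =o cardinal_min |D| |C| \<and> cardinal_min |D| |C| <o |X|"
    then have "|C| \<le>o |D|"
      using ordIso_imp_ordLeq ordLeq_total [OF card_of_Well_order card_of_Well_order, of D C]
      by (auto simp: cardinal_min_def split: if_splits)
    moreover have "|C| <o |X|" using h ordIso_ordLess_trans by blast
    ultimately show "has_top_design1 T C D" using h inf infD b by blast
  next
    show "has_top_design1 T C D \<longleftrightarrow> D = X" if "|C| =o |D| \<and> |D| =o |X|"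
      using that full single b assms(6) by blast
  qed
  from a c pt show ?thesis by blast
qed

end
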